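(* Let $n,m\ge 2$ be integers and let the parameters $a_i,\bar a_i$ $(1\le i\le n+m)$ and the quantities $d,r,\rho$ be as in the context. Suppose $r>1/2$ (that is, $n\ge m$) and $0<d<r$. Then the system $(S)$, and thus the eigenvalue problem $(EV)$, admits a unique positive eigenvalue $\lambda$, and it is given by $$\lambda=\min\Big\{\frac{d}{1+\rho},\ \frac14,\ \frac{r-d}{2r-1+\rho}\Big\}>0 .$$ Here both systems are the ones written in the context.
   Context: All formulas are in ordinary real arithmetic (the min-plus notation of the source has been expanded). Parameters: $n,m\ge 2$ are integers; $a_1,\dots,a_{n+m}$ are real numbers with $0\le a_i\le 1$ for all $i$ and $a_n+a_{n+m}\le 1$. Put $\bar a_i=1-a_i$ for $i\ne n,n+m$, and $\bar a_n=\bar a_{n+m}=1-a_n-a_{n+m}$. Put $$b=\sum_{i=1}^{n-1}a_i,\quad \bar b=\sum_{i=1}^{n-1}\bar a_i,\quad b'=\sum_{i=n+1}^{n+m-1}a_i,\quad \bar b'=\sum_{i=n+1}^{n+m-1}\bar a_i ,$$ $$d=\frac{1}{n+m-1}\sum_{i=1}^{n+m}a_i,\qquad r=\frac{n}{n+m-1},\qquad \rho=\frac{1}{n+m-1}.$$ Let $I=\{i: 2\le i\le n-1\}\cup\{i: n+2\le i\le n+m-1\}$ (either part may be empty). System $(EV)$ (unknowns $\lambda\in\mathbb{R}$, $x\in\mathbb{R}^{n+m}$): $$\lambda+x_i=\min\{a_{i-1}+x_{i-1},\ \bar a_i+x_{i+1}\}\quad (i\in I),$$ $$\lambda+x_n=\min\{\bar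 a_n+x_1+x_{n+1}-\lambda-x_{n+m},\ a_{n-1}+x_{n-1}\},$$ $$\lambda+x_{n+m}=\min\{\bar a_{n+m}+x_1+x_{n+1}-x_n,\ a_{n+m-1}+x_{n+m-1}\},$$ $$\lambda+x_1=\min\{a_n+\tfrac12(x_n+x_{n+m}),\ \bar a_1+x_2\},$$ $$\lambda+x_{n+1}=\min\{a_{n+m}+\tfrac12(x_n+x_{n+m}),\ \bar a_{n+1}+x_{n+2}\}.$$ System $(S)$ (unknowns $\lambda,x_1,x_n,x_{n+1},x_{n+m}\in\mathbb{R}$): $$x_n=\min\{\bar a_n-2\lambda+x_1+x_{n+1}-x_{n+m},\ b-(n-1)\lambda+x_1\},$$ $$x_{n+m}=\min\{\bar a_{n+m}-\lambda+x_1+x_{n+1}-x_n,\ b'-(m-1)\lambda+x_{n+1}\},$$ $$x_1=\min\{a_n-\lambda+\tfrac12(x_n+x_{n+m}),\ \bar b-(n-1)\lambda+x_n\},$$ $$x_{n+1}=\min\{a_{n+m}-\lambda+\tfrac12(x_n+x_{n+m}),\ \bar b'-(m-1)\lambda+x_{n+m}\}.$$ An eigenvalue of one of these systems is a real number $\lambda$ for which there exists a real vector $x$ (in $\mathbb{R}^{n+m}$ for $(EV)$, in $\mathbb{R}^4$ for $(S)$) such that $(\lambda,x)$ satisfies the system. *)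

theory Defs
  imports Complex_Main
begin

text \<open>
  Families indexed by \<open>1, ..., n + m\<close> (the parameters \<open>a\<close> and the unknown vector \<open>x\<close> of
  the system (EV)) are functions on \<^typ>\<open>nat\<close>; no value outside \<open>{1..n + m}\<close> is ever used.
\<close>

definition admissible :: "nat \<Rightarrow> nat \<Rightarrow> (nat \<Rightarrow> real) \<Rightarrow> bool" where
  "admissible n m a \<longleftrightarrow>
     (\<forall>i\<in>{1..n + m}. 0 \<le> a i \<and> a i \<le> 1) \<and> a n + a (n + m) \<le> 1"

definition abar :: "nat \<Rightarrow> nat \<Rightarrow> (nat \<Rightarrow> real) \<Rightarrow> nat \<Rightarrow> real" where
  "abar n m a i = (if i = n \<or> i = n + m then 1 - a n - a (n + m) else 1 - a i)"

definition density :: "nat \<Rightarrow> nat \<Rightarrow> (nat \<Rightarrow> real) \<Rightarrow> real" where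
  "density n m a = 1 / (real n + real m - 1) * (\<Sum>i = 1..n + m. a i)"

definition ratio :: "nat \<Rightarrow> nat \<Rightarrow> real" where
  "ratio n m = real n / (real n + real m - 1)"

definition rho :: "nat \<Rightarrow> nat \<Rightarrow> real" where
  "rho n m = 1 / (real n + real m - 1)"

definition EV_system ::
  "nat \<Rightarrow> nat \<Rightarrow> (nat \<Rightarrow> real) \<Rightarrow> real \<Rightarrow> (nat \<Rightarrow> real) \<Rightarrow> bool" where
  "EV_system n m a l x \<longleftrightarrow>
     (\<forall>i \<in> {2..n - 1} \<union> {n + 2..n + m - 1}.
        l + x i = min (a (i - 1) + x (i - 1)) (abar n m a i + x (i + 1))) \<and>
     l + x n = min (abar n m a n + x 1 + x (n + 1) - l - x (n + m))
                   (a (n - 1) + x (n - 1)) \<and>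
     l + x (n + m) = min (abar n m a (n + m) + x 1 + x (n + 1) - x n)
                         (a (n + m - 1) + x (n + m - 1)) \<and>
     l + x 1 = min (a n + 1 / 2 * (x n + x (n + m))) (abar n m a 1 + x 2) \<and>
     l + x (n + 1) = min (a (n + m) + 1 / 2 * (x n + x (n + m)))
                         (abar n m a (n + 1) + x (n + 2))"

definition EV_eigenvalue :: "nat \<Rightarrow> nat \<Rightarrow> (nat \<Rightarrow> real) \<Rightarrow> real \<Rightarrow> bool" where
  "EV_eigenvalue n m a l \<longleftrightarrow> (\<exists>x. EV_system n m a l x)"

text \<open>The real unknowns \<open>x1, xn, y1, ym\<close> stand for \<open>x\<^sub>1\<close>, \<open>x\<^sub>n\<close>, \<open>x\<^bsub>n+1\<^esub>\<close>, \<open>x\<^bsub>n+m\<^esub>\<close>.\<close>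

definition S_system ::
  "nat \<Rightarrow> nat \<Rightarrow> (nat \<Rightarrow> real) \<Rightarrow> real \<Rightarrow> real \<Rightarrow> real \<Rightarrow> real \<Rightarrow> real \<Rightarrow> bool" where
  "S_system n m a l x1 xn y1 ym \<longleftrightarrow>
     (let b = (\<Sum>i = 1..n - 1. a i);
          bb = (\<Sum>i = 1..n - 1. abar n m a i);
          b' = (\<Sum>i = n + 1..n + m - 1. a i);
          bb' = (\<Sum>i = n + 1..n + m - 1. abar n m a i)
      in
        xn = min (abar n m a n - 2 * l + x1 + y1 - ym) (b - (real n - 1) * l + x1) \<and>
        ym = min (abar n m a (n + m) - l + x1 + y1 - xn) (b' - (real m - 1) * l + y1) \<and>
        x1 = min (a n - l + 1 / 2 * (xn + ym)) (bb - (real n - 1) * l + xn) \<and>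
        y1 = min (a (n + m) - l + 1 / 2 * (xn + ym)) (bb' - (real m - 1) * l + ym))"

definition S_eigenvalue :: "nat \<Rightarrow> nat \<Rightarrow> (nat \<Rightarrow> real) \<Rightarrow> real \<Rightarrow> bool" where
  "S_eigenvalue n m a l \<longleftrightarrow> (\<exists>x1 xn y1 ym. S_system n m a l x1 xn y1 ym)"

end

theory Submission
  imports Defs
begin

text \<open>
  Adding the bounds on \<open>x\<^sub>n + x\<^bsub>n+m\<^esub>\<close>, \<open>x\<^sub>1\<close> and \<open>x\<^bsub>n+1\<^esub>\<close> gives \<open>\<lambda> \<le> 1/4\<close>. Since
  \<open>a\<^sub>i + abar\<^sub>i = 1 > 2\<lambda>\<close>, going forth and back along an edge of one of the two roads strictly
  increases the value, so minimal walks through a road never turn around; this eliminates the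
  interior unknowns and identifies (EV) with (S).

  In (S), positivity of \<open>\<lambda>\<close> forces the second term of the minimum for \<open>x\<^bsub>n+m\<^esub>\<close> to be active, and
  \<open>\<lambda> < 1/2\<close> then forces the first term for \<open>x\<^bsub>n+1\<^esub>\<close>. Normalising \<open>x\<^sub>n + x\<^bsub>n+m\<^esub> = 0\<close>, everything is
  explicit in \<open>\<lambda>\<close>, and the remaining two minima give the three inequalities, one of them tight,
  that characterise \<open>\<lambda>\<close>.
\<close>

text \<open>Clearing denominators gives the closed formula the shape in which the system delivers
  \<open>l\<close>: three linear bounds, one of them attained.\<close>

lemma eq_Min3_quotients_iff:
  fixes l A B :: real
  assumes "P > 0" "Q > 0"
  shows "l = Min {A / P, 1 / 4, B / Q} \<longleftrightarrow>
    P * l \<le> A \<and> 4 * l \<le> 1 \<and> Q * l \<le> B \<and> (P * l = A \<or> 4 * l = 1 \<or> Q * l = B)"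
proof -
  have Min3: "l = Min {x, y, z} \<longleftrightarrow> l \<le> x \<and> l \<le> y \<and> l \<le> z \<and> (l = x \<or> l = y \<or> l = z)"
    for x y z :: real
    by (auto simp: min_def)
  have "l \<le> A / P \<longleftrightarrow> P * l \<le> A" "l = A / P \<longleftrightarrow> P * l = A"
       "l \<le> B / Q \<longleftrightarrow> Q * l \<le> B" "l = B / Q \<longleftrightarrow> Q * l = B"
    using assms by (simp_all add: field_simps)
  moreover have "l = Min {A / P, 1 / 4, B / Q} \<longleftrightarrow>
      l \<le> A / P \<and> l \<le> 1 / 4 \<and> l \<le> B / Q \<and> (l = A / P \<or> l = 1 / 4 \<or> l = B / Q)"
    using Min3[of "A / P" "1 / 4" "B / Q"] .
  moreover have "l \<le> 1 / 4 \<longleftrightarrow> 4 * l \<le> 1" "l = 1 / 4 \<longleftrightarrow> 4 * l = 1" by auto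
  ultimately show ?thesis by (simp only:)
qed

section \<open>Solving the four-unknown system\<close>

text \<open>This is (S) with road sums and lengths as free reals. \<open>\<gamma>\<close> is the
  common value of \<open>abar\<close> at \<open>n\<close> and \<open>n + m\<close>, and
  \<open>N - 1 - b\<close>, \<open>M - 1 - b'\<close> replace the sums of
  \<open>abar\<close>.\<close>

definition junction_system ::
  "real \<Rightarrow> real \<Rightarrow> real \<Rightarrow> real \<Rightarrow> real \<Rightarrow> real \<Rightarrow> real \<Rightarrow> real \<Rightarrow> real \<Rightarrow> real \<Rightarrow> real \<Rightarrow> real \<Rightarrow> bool" where
  "junction_system N M \<alpha> \<beta> b b' \<gamma> l u p v q \<longleftrightarrow>
     p = min (\<gamma> - 2 * l + u + v - q) (b - (N - 1) * l + u) \<and>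
     q = min (\<gamma> - l + u + v - p) (b' - (M - 1) * l + v) \<and>
     u = min (\<alpha> - l + 1 / 2 * (p + q)) (N - 1 - b - (N - 1) * l + p) \<and>
     v = min (\<beta> - l + 1 / 2 * (p + q)) (M - 1 - b' - (M - 1) * l + q)"

lemma eq_minD:
  fixes x :: "'a :: linorder"
  assumes "x = min y z"
  shows "x \<le> y \<and> x \<le> z \<and> (x = y \<or> x = z)"
  using assms by (simp add: min_def split: if_splits)

lemma junction_system_le_quarter:
  assumes "junction_system N M \<alpha> \<beta> b b' (1 - \<alpha> - \<beta>) l u p v q"
  shows "l \<le> 1 / 4"
proof -
  note S = assms[unfolded junction_system_def]
  have "p \<le> 1 - \<alpha> - \<beta> - 2 * l + u + v - q \<and>
    u \<le> \<alpha> - l + 1 / 2 * (p + q) \<and> v \<le> \<beta> - l + 1 / 2 * (p + q)"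
    using eq_minD[OF S[THEN conjunct1]]
      eq_minD[OF S[THEN conjunct2, THEN conjunct2, THEN conjunct1]]
      eq_minD[OF S[THEN conjunct2, THEN conjunct2, THEN conjunct2]] by blast
  then show ?thesis by (simp add: field_simps)
qed

text \<open>Once \<open>q\<close> and \<open>v\<close> are determined, the case split is on the
  active term of \<open>p\<close>: the road term makes the first bound tight, while the junction
  term leaves the minimum for \<open>u\<close> to choose between the other two.\<close>

lemma junction_system_necessary:
  fixes l N M \<alpha> \<beta> b b' :: real
  assumes "junction_system N M \<alpha> \<beta> b b' (1 - \<alpha> - \<beta>) l u p v q"
    and "l > 0" "N > 1" "M > 1"
  defines "A \<equiv> b + b' + \<alpha> + \<beta>"
  shows "(N + M) * l \<le> A \<and> 4 * l \<le> 1 \<and> (N - M + 2) * l \<le> N - A \<and>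
     ((N + M) * l = A \<or> 4 * l = 1 \<or> (N - M + 2) * l = N - A)"
proof -
  \<comment> \<open>Naming the products and the half-sum leaves only linear arithmetic.\<close>
  define k where "k = (N - 1) * l"
  define j where "j = (M - 1) * l"
  define t where "t = 1 / 2 * (p + q)"
  have t: "p + q = 2 * t" by (simp add: t_def)
  have ex: "(N + M) * l = k + j + 2 * l" "(N - M + 2) * l = k - j + 2 * l"
    by (simp_all add: k_def j_def algebra_simps)
  note S = assms(1)[unfolded junction_system_def, folded k_def j_def t_def]
  note P = eq_minD[OF S[THEN conjunct1]]
  note Q = eq_minD[OF S[THEN conjunct2, THEN conjunct1]]
  note U = eq_minD[OF S[THEN conjunct2, THEN conjunct2, THEN conjunct1]]
  note V = eq_minD[OF S[THEN conjunct2, THEN conjunct2, THEN conjunct2]]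
  have l4: "4 * l \<le> 1" using junction_system_le_quarter[OF assms(1)] by simp
  have slack: "2 * k < N - 1" "2 * j < M - 1"
    using l4 \<open>N > 1\<close> \<open>M > 1\<close> mult_strict_left_mono[of l "1/2" "N - 1"]
      mult_strict_left_mono[of l "1/2" "M - 1"] by (simp_all add: k_def j_def)
  \<comment> \<open>The junction term for \<open>q\<close> would give \<open>p + q\<close> a value
    exceeding the bound from \<open>P\<close> by \<open>l\<close>.\<close>
  have q: "q = b' - j + v" using P Q \<open>l > 0\<close> by linarith
  \<comment> \<open>The other term, combined with \<open>q\<close>, would force
    \<open>2 * j = M - 1\<close>.\<close>
  have v: "v = \<beta> - l + t" using V q slack by linarith
  have A: "A = b + b' + \<alpha> + \<beta>" by (simp add: A_def)
  have "k + j + 2 * l \<le> A \<and> 4 * l \<le> 1 \<and> k - j + 2 * l \<le> N - A \<and>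
    (k + j + 2 * l = A \<or> 4 * l = 1 \<or> k - j + 2 * l = N - A)"
  proof (cases "p = b - k + u")
    case True
    then have u: "u = \<alpha> - l + t" using U slack by linarith
    have tight: "k + j + 2 * l = A" using True q u v A t by linarith
    then have "k - j + 2 * l \<le> N - A" using slack(1) l4 by linarith
    with tight l4 show ?thesis by simp
  next
    case False
    then have p: "p = 1 - \<alpha> - \<beta> - 2 * l + u + v - q" "p \<le> b - k + u"
      using P by blast+
    have u: "u = 3 * l - 1 + \<alpha> + t" using p(1) v t by linarith
    have "k + j + 2 * l \<le> A" using p(2) u q v l4 A t by linarith
    \<comment> \<open>With this \<open>u\<close>, equality with the first term for \<open>u\<close>
      means \<open>4 * l = 1\<close>, and with the second it means that this bound is tight.\<close>
    moreover have "k - j + 2 * l \<le> N - A" using U u q v A t by linarith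
    moreover have "4 * l = 1 \<or> k - j + 2 * l = N - A" using U u q v A t by linarith
    ultimately show ?thesis using l4 by blast
  qed
  then show ?thesis by (simp only: ex)
qed

text \<open>The witnesses are the values forced in the necessity proof for \<open>t = 0\<close>:
  \<open>q = b' - (M - 1) * l + v\<close> yields \<open>p = - q\<close>, and \<open>u\<close>
  follows the same case split on the active term of \<open>p\<close>.\<close>

lemma junction_system_sufficient:
  fixes l N M \<alpha> \<beta> b b' :: real
  assumes "l > 0" "N \<ge> 1" "M \<ge> 1"
  defines "A \<equiv> b + b' + \<alpha> + \<beta>"
  assumes "(N + M) * l \<le> A" "4 * l \<le> 1" "(N - M + 2) * l \<le> N - A"
    and tight: "(N + M) * l = A \<or> 4 * l = 1 \<or> (N - M + 2) * l = N - A"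
  shows "\<exists>u p v q. junction_system N M \<alpha> \<beta> b b' (1 - \<alpha> - \<beta>) l u p v q"
proof -
  \<comment> \<open>the solution with \<open>p + q = 0\<close>\<close>
  define u where "u = (if (N + M) * l = A then \<alpha> - l else 3 * l - 1 + \<alpha>)"
  define p where "p = M * l - b' - \<beta>"
  define v where "v = \<beta> - l"
  have M: "2 * (M * l) - 2 * l \<le> M - 1" and N: "2 * (N * l) - 2 * l \<le> N - 1"
    using assms mult_left_mono[of l "1/2" "M - 1"] mult_left_mono[of l "1/2" "N - 1"]
    by (simp_all add: algebra_simps)
  have facts: "N * l + M * l \<le> b + b' + \<alpha> + \<beta>"
     "N * l - M * l + 2 * l \<le> N - (b + b' + \<alpha> + \<beta>)"
    using assms by (simp_all add: A_def algebra_simps)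
  have u_eq: "(N * l + M * l = b + b' + \<alpha> + \<beta> \<and> u = \<alpha> - l) \<or>
     u = 3 * l - 1 + \<alpha> \<and> (4 * l = 1 \<or> N * l - M * l + 2 * l = N - (b + b' + \<alpha> + \<beta>))"
    using tight by (auto simp: u_def A_def algebra_simps)
  have minI: "x = min y z" if "x \<le> y" "x \<le> z" "x = y \<or> x = z" for x y z :: real
    using that by auto
  have "p = min (1 - \<alpha> - \<beta> - 2 * l + u + v - (- p)) (b - (N - 1) * l + u)"
    by (rule minI) (use u_eq facts N assms(6) in \<open>auto simp: p_def v_def algebra_simps\<close>)
  moreover have "- p = min (1 - \<alpha> - \<beta> - l + u + v - p) (b' - (M - 1) * l + v)"
    by (rule minI) (use u_eq assms(1,6) in \<open>auto simp: p_def v_def algebra_simps\<close>)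
  moreover have "u = min (\<alpha> - l + 1 / 2 * (p + - p)) (N - 1 - b - (N - 1) * l + p)"
    by (rule minI) (use u_eq facts N assms(6) in \<open>auto simp: p_def algebra_simps\<close>)
  moreover have "v = min (\<beta> - l + 1 / 2 * (p + - p)) (M - 1 - b' - (M - 1) * l + - p)"
    by (rule minI) (use M in \<open>auto simp: p_def v_def algebra_simps\<close>)
  ultimately show ?thesis unfolding junction_system_def by blast
qed

section \<open>Eliminating the interior of a road\<close>

lemma walk_le:
  fixes x :: "nat \<Rightarrow> real"
  assumes "p \<le> q" "\<And>i. i \<in> {p..<q} \<Longrightarrow> x (Suc i) - x i \<le> f i"
  shows "x q - x p \<le> sum f {p..<q}"
  using sum_mono[of "{p..<q}" "\<lambda>i. x (Suc i) - x i" f] assms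
  by (simp add: sum_Suc_diff')

lemma walk_eq:
  fixes x :: "nat \<Rightarrow> real"
  assumes "p \<le> q" "\<And>i. i \<in> {p..<q} \<Longrightarrow> x (Suc i) - x i = f i"
  shows "x q - x p = sum f {p..<q}"
proof -
  have "(\<Sum>i = p..<q. x (Suc i) - x i) = sum f {p..<q}"
    by (rule sum.cong) (use assms in auto)
  then show ?thesis using \<open>p \<le> q\<close> by (simp add: sum_Suc_diff')
qed

text \<open>The equations at \<open>p\<close> and \<open>q\<close> are left out because their
  junction terms involve the other road; they enter the lemmas below through arbitrary constants
  \<open>C\<close> and \<open>D\<close>.\<close>

definition road_interior :: "nat \<Rightarrow> nat \<Rightarrow> (nat \<Rightarrow> real) \<Rightarrow> (nat \<Rightarrow> real) \<Rightarrow> real \<Rightarrow> (nat \<Rightarrow> real) \<Rightarrow> bool" where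
  "road_interior p q a c l x \<longleftrightarrow>
     (\<forall>i\<in>{p<..<q}. l + x i = min (a (i - 1) + x (i - 1)) (c i + x (i + 1)))"

lemma road_interiorD:
  assumes "road_interior p q a c l x" "p \<le> i" "Suc i < q"
  shows "l + x (Suc i) = min (a i + x i) (c (Suc i) + x (Suc (Suc i)))"
  using assms unfolding road_interior_def by (auto dest: bspec[where x = "Suc i"])

text \<open>Forward steps always give the upper bound. If \<open>C\<close> is not active at
  \<open>q\<close>, the minimum there comes from \<open>q - 1\<close>, and this propagates down to
  \<open>p\<close>, so that the bound is attained.\<close>

lemma road_interior_end:
  fixes C :: real
  assumes "p < q" and "l < 1 / 2" and ac: "\<forall>i\<in>{p..<q}. a i + c i = 1"
    and R: "road_interior p q a c l x"
    and E: "l + x q = min C (a (q - 1) + x (q - 1))"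
  shows "x q = min (C - l) (sum a {p..<q} - real (q - p) * l + x p)"
proof -
  have step_le: "x (Suc i) - x i \<le> a i - l" if "i \<in> {p..<q}" for i
  proof (cases "Suc i = q")
    case True
    with E show ?thesis by (auto simp: min_def split: if_splits)
  next
    case False
    with road_interiorD[OF R, of i] that show ?thesis by (auto simp: min_def split: if_splits)
  qed
  have upper: "x q - x p \<le> sum a {p..<q} - real (q - p) * l"
    using walk_le[of p q x "\<lambda>i. a i - l", OF _ step_le] \<open>p < q\<close> by (simp add: sum_subtractf)
  show ?thesis
  proof (cases "l + x q = C")
    case True
    with upper show ?thesis by (simp add: min_def)
  next
    case False
    have step_eq: "x (Suc i) - x i = a i - l" if "p \<le> i" "i < q" for i
    proof -
      have "i \<le> q - 1" using that by simp
      then have "p \<le> i \<longrightarrow> x (Suc i) - x i = a i - l"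
      proof (induction rule: inc_induct)
        case base
        then show ?case using False E \<open>p < q\<close> by (auto simp: min_def split: if_splits)
      next
        case (step i)
        \<comment> \<open>turning back over the edge \<open>Suc i\<close> would cost \<open>1 - 2 * l > 0\<close>\<close>
        moreover have "Suc i < q" using step.hyps by simp
        ultimately show ?case using road_interiorD[OF R, of i] bspec[OF ac, of "Suc i"] \<open>l < 1 / 2\<close>
          by (auto simp: min_def split: if_splits)
      qed
      with that show ?thesis by simp
    qed
    have "x q - x p = sum a {p..<q} - real (q - p) * l"
      using walk_eq[of p q x "\<lambda>i. a i - l"] step_eq \<open>p < q\<close> by (simp add: sum_subtractf)
    then show ?thesis using E by (auto simp: min_def split: if_splits)
  qed
qed

lemma road_interior_start:
  fixes D :: real
  assumes "p < q" and "l < 1 / 2" and ac: "\<forall>i\<in>{p..<q}. a i + c i = 1"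
    and R: "road_interior p q a c l x"
    and E: "l + x p = min D (c p + x (p + 1))"
  shows "x p = min (D - l) (sum c {p..<q} - real (q - p) * l + x q)"
proof -
  \<comment> \<open>Negating \<open>x\<close> lets the walk lemmas, which sum by increasing index,
    handle the walk from \<open>q\<close> back to \<open>p\<close>.\<close>
  have step_ge: "- x (Suc i) - - x i \<le> c i - l" if "i \<in> {p..<q}" for i
  proof (cases "i = p")
    case True
    with E show ?thesis by (auto simp: min_def split: if_splits)
  next
    case False
    then have "p < i" using that by simp
    then obtain j where "i = Suc j" "p \<le> j" by (cases i) auto
    with road_interiorD[OF R, of j] that show ?thesis by (auto simp: min_def split: if_splits)
  qed
  have upper: "x p - x q \<le> sum c {p..<q} - real (q - p) * l"
    using walk_le[of p q "\<lambda>i. - x i" "\<lambda>i. c i - l", OF _ step_ge] \<open>p < q\<close>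
    by (simp add: sum_subtractf)
  show ?thesis
  proof (cases "l + x p = D")
    case True
    with upper show ?thesis by (simp add: min_def)
  next
    case False
    have step_eq: "- x (Suc i) - - x i = c i - l" if "p \<le> i" "i < q" for i
      using that
    proof (induction rule: dec_induct)
      case base
      then show ?case using False E by (auto simp: min_def split: if_splits)
    next
      case (step i)
      then show ?case using road_interiorD[OF R, of i] bspec[OF ac, of i] \<open>l < 1 / 2\<close>
        by (auto simp: min_def split: if_splits)
    qed
    have "x p - x q = sum c {p..<q} - real (q - p) * l"
      using walk_eq[of p q "\<lambda>i. - x i" "\<lambda>i. c i - l"] step_eq \<open>p < q\<close> by (simp add: sum_subtractf)
    then show ?thesis using E by (auto simp: min_def split: if_splits)
  qed
qed

text \<open>Converse of the elimination: each interior value is the cheaper of the direct walks from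
  the two ends.\<close>

lemma road_fill:
  fixes xp xq C D :: real
  assumes "p < q" and "l \<le> 1 / 2" and ac: "\<forall>i\<in>{p..<q}. a i + c i = 1"
    and xq: "xq = min (C - l) (sum a {p..<q} - real (q - p) * l + xp)"
    and xp: "xp = min (D - l) (sum c {p..<q} - real (q - p) * l + xq)"
  obtains x where "x p = xp" "x q = xq" "road_interior p q a c l x"
    "l + x q = min C (a (q - 1) + x (q - 1))" "l + x p = min D (c p + x (p + 1))"
proof -
  define F where "F i = sum a {p..<i} - real (i - p) * l + xp" for i
  define B where "B i = sum c {i..<q} - real (q - i) * l + xq" for i
  define x where "x i = min (F i) (B i)" for i
  have F: "F (Suc i) = F i + a i - l" if "p \<le> i" for i
    using that by (simp add: F_def Suc_diff_le algebra_simps)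
  have B: "B i = B (Suc i) + c i - l" if "i < q" for i
    using that by (simp add: B_def sum.atLeast_Suc_lessThan Suc_diff_Suc[symmetric] algebra_simps)
  have ends: "F p = xp" "B q = xq" by (simp_all add: F_def B_def)
  have xpB: "xp = min (D - l) (B p)" and xqF: "xq = min (C - l) (F q)"
    using xp xq by (simp_all add: B_def F_def)
  \<comment> \<open>The assumed minima give \<open>xp \<le> B p\<close> and
    \<open>xq \<le> F q\<close>, so the prescribed end values survive.\<close>
  then have xp': "x p = xp" and xq': "x q = xq" using ends by (simp_all add: x_def)
  obtain k where k: "q = Suc k" "p \<le> k" using \<open>p < q\<close> by (cases q) auto
  have "road_interior p q a c l x"
    unfolding road_interior_def
  proof
    fix i assume i: "i \<in> {p<..<q}"
    then obtain j where j: "i = Suc j" "p \<le> j" by (cases i) auto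
    show "l + x i = min (a (i - 1) + x (i - 1)) (c i + x (i + 1))"
      \<comment> \<open>The mixed terms, \<open>B\<close> in the forward step and \<open>F\<close>
        in the backward one, contain a turn of cost \<open>1 - 2 * l \<ge> 0\<close> and never
        undercut the minimum.\<close>
      using i j F[of j] F[of i] B[of j] B[of i] bspec[OF ac, of j] bspec[OF ac, of i] \<open>l \<le> 1 / 2\<close>
      by (auto simp: x_def min_def)
  qed
  moreover have "l + x q = min C (a (q - 1) + x (q - 1))"
    using k F[of k] B[of k] bspec[OF ac, of k] \<open>l \<le> 1 / 2\<close> xq' xqF ends x_def[of k]
    by (auto simp: min_def split: if_splits)
  moreover have "l + x p = min D (c p + x (p + 1))"
    using \<open>p < q\<close> F[of p] B[of p] bspec[OF ac, of p] \<open>l \<le> 1 / 2\<close> xp' xpB ends x_def[of "p + 1"]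
    by (auto simp: min_def split: if_splits)
  ultimately show thesis using that xp' xq' by blast
qed

section \<open>Equivalence of (EV) and (S)\<close>

lemma sum_abar_roads:
  assumes "n \<ge> 2" "m \<ge> 2"
  shows "(\<Sum>i = 1..<n. abar n m a i) = real n - 1 - (\<Sum>i = 1..<n. a i)"
    and "(\<Sum>i = n + 1..<n + m. abar n m a i) = real m - 1 - (\<Sum>i = n + 1..<n + m. a i)"
proof -
  have "(\<Sum>i = 1..<n. abar n m a i) = (\<Sum>i = 1..<n. 1 - a i)"
    by (rule sum.cong) (auto simp: abar_def)
  moreover have "(\<Sum>i = n + 1..<n + m. abar n m a i) = (\<Sum>i = n + 1..<n + m. 1 - a i)"
    by (rule sum.cong) (auto simp: abar_def)
  ultimately show "(\<Sum>i = 1..<n. abar n m a i) = real n - 1 - (\<Sum>i = 1..<n. a i)"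
    and "(\<Sum>i = n + 1..<n + m. abar n m a i) = real m - 1 - (\<Sum>i = n + 1..<n + m. a i)"
    using assms by (simp_all add: sum_subtractf of_nat_diff)
qed

lemma S_system_iff_junction_system:
  assumes "n \<ge> 2" "m \<ge> 2"
  shows "S_system n m a l u p v q \<longleftrightarrow>
    junction_system (real n) (real m) (a n) (a (n + m)) (sum a {1..<n}) (sum a {n + 1..<n + m})
      (1 - a n - a (n + m)) l u p v q"
proof -
  have sets: "{1..n - 1} = {1..<n}" "{n + 1..n + m - 1} = {n + 1..<n + m}"
    using assms by auto
  have "abar n m a n = 1 - a n - a (n + m)" "abar n m a (n + m) = 1 - a n - a (n + m)"
    by (simp_all add: abar_def)
  then show ?thesis
    unfolding S_system_def junction_system_def Let_def sets sum_abar_roads[OF assms] by simp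
qed

text \<open>Proved directly on (EV), since passing from (EV) to (S) already requires
  \<open>l < 1 / 2\<close>.\<close>

lemma EV_system_le_quarter:
  assumes "EV_system n m a l x"
  shows "l \<le> 1 / 4"
proof -
  have "l + x n \<le> abar n m a n + x 1 + x (n + 1) - l - x (n + m) \<and>
    l + x 1 \<le> a n + 1 / 2 * (x n + x (n + m)) \<and>
    l + x (n + 1) \<le> a (n + m) + 1 / 2 * (x n + x (n + m))"
    using assms unfolding EV_system_def by (blast dest: eq_minD)
  then show ?thesis by (simp add: abar_def field_simps)
qed

text \<open>The junction terms depend only on the four end values, so once these are fixed the two
  roads can be eliminated or filled independently.\<close>

lemma EV_eigenvalue_iff_S_eigenvalue:
  assumes "n \<ge> 2" "m \<ge> 2"
  shows "EV_eigenvalue n m a l \<longleftrightarrow> S_eigenvalue n m a l"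
proof -
  let ?c = "abar n m a"
  note sums = sum_abar_roads[OF assms, of a]
  have I: "{2..n - 1} \<union> {n + 2..n + m - 1} = {1<..<n} \<union> {n + 1<..<n + m}"
    using assms by auto
  have ac1: "\<forall>i\<in>{1..<n}. a i + ?c i = 1" by (simp add: abar_def)
  have ac2: "\<forall>i\<in>{n + 1..<n + m}. a i + ?c i = 1" by (simp add: abar_def)
  have EV: "EV_system n m a l x \<longleftrightarrow>
      road_interior 1 n a ?c l x \<and> road_interior (n + 1) (n + m) a ?c l x \<and>
      l + x n = min (?c n + x 1 + x (n + 1) - l - x (n + m)) (a (n - 1) + x (n - 1)) \<and>
      l + x 1 = min (a n + 1 / 2 * (x n + x (n + m))) (?c 1 + x (1 + 1)) \<and>
      l + x (n + m) = min (?c (n + m) + x 1 + x (n + 1) - x n) (a (n + m - 1) + x (n + m - 1)) \<and>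
      l + x (n + 1) = min (a (n + m) + 1 / 2 * (x n + x (n + m))) (?c (n + 1) + x (n + 1 + 1))" for x
    unfolding EV_system_def road_interior_def I by (auto simp: numeral_2_eq_2)
  \<comment> \<open>The terms are regrouped as \<open>C - l\<close> and \<open>D - l\<close>, with
    road lengths as natural differences, to match the road lemmas.\<close>
  have S: "S_system n m a l u p v q \<longleftrightarrow>
      p = min (?c n + u + v - l - q - l) (sum a {1..<n} - real (n - 1) * l + u) \<and>
      u = min (a n + 1 / 2 * (p + q) - l) (sum ?c {1..<n} - real (n - 1) * l + p) \<and>
      q = min (?c (n + m) + u + v - p - l)
            (sum a {n + 1..<n + m} - real (n + m - (n + 1)) * l + v) \<and>
      v = min (a (n + m) + 1 / 2 * (p + q) - l)
            (sum ?c {n + 1..<n + m} - real (n + m - (n + 1)) * l + q)" for u p v q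
    using assms unfolding S_system_iff_junction_system[OF assms] junction_system_def sums
    by (auto simp: abar_def of_nat_diff algebra_simps)
  have n: "1 < n" "n + 1 < n + m" using assms by simp_all
  show ?thesis
  proof
    assume "EV_eigenvalue n m a l"
    then obtain x where x: "EV_system n m a l x" unfolding EV_eigenvalue_def by blast
    have l: "l < 1 / 2" using EV_system_le_quarter[OF x] by simp
    note x' = x[unfolded EV]
    have "S_system n m a l (x 1) (x n) (x (n + 1)) (x (n + m))"
      unfolding S
      using road_interior_end[OF n(1) l ac1, where x = x] road_interior_start[OF n(1) l ac1, where x = x]
        road_interior_end[OF n(2) l ac2, where x = x] road_interior_start[OF n(2) l ac2, where x = x] x'
      by blast
    then show "S_eigenvalue n m a l" unfolding S_eigenvalue_def by blast
  next
    assume "S_eigenvalue n m a l"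
    then obtain u p v q where s: "S_system n m a l u p v q" unfolding S_eigenvalue_def by blast
    have l: "l \<le> 1 / 2"
      using junction_system_le_quarter s[unfolded S_system_iff_junction_system[OF assms]]
      by fastforce
    note s' = s[unfolded S]
    obtain x where x: "x 1 = u" "x n = p" "road_interior 1 n a ?c l x"
      "l + x n = min (?c n + u + v - l - q) (a (n - 1) + x (n - 1))"
      "l + x 1 = min (a n + 1 / 2 * (p + q)) (?c 1 + x (1 + 1))"
      using road_fill[OF n(1) l ac1] s' by blast
    obtain y where y: "y (n + 1) = v" "y (n + m) = q" "road_interior (n + 1) (n + m) a ?c l y"
      "l + y (n + m) = min (?c (n + m) + u + v - p) (a (n + m - 1) + y (n + m - 1))"
      "l + y (n + 1) = min (a (n + m) + 1 / 2 * (p + q)) (?c (n + 1) + y (n + 1 + 1))"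
      using road_fill[OF n(2) l ac2] s' by blast
    define z where "z i = (if i \<le> n then x i else y i)" for i
    have "road_interior 1 n a ?c l z" "road_interior (n + 1) (n + m) a ?c l z"
      using x(3) y(3) by (auto simp: road_interior_def z_def)
    moreover have "z 1 = x 1" "z (1 + 1) = x (1 + 1)" "z (n - 1) = x (n - 1)" "z n = x n"
      "z (n + 1) = y (n + 1)" "z (n + 1 + 1) = y (n + 1 + 1)"
      "z (n + m - 1) = y (n + m - 1)" "z (n + m) = y (n + m)"
      using assms by (auto simp: z_def)
    ultimately have "EV_system n m a l z"
      unfolding EV using x(1,2,4,5) y(1,2,4,5) by (simp only: simp_thms)
    then show "EV_eigenvalue n m a l" unfolding EV_eigenvalue_def by blast
  qed
qed

section \<open>The positive eigenvalue\<close>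

text \<open>The road sums and junction parameters enter the three bounds only through their total
  \<open>A\<close>.\<close>

lemma S_eigenvalue_iff:
  fixes a :: "nat \<Rightarrow> real"
  assumes "n \<ge> 2" "m \<ge> 2" "l > 0"
  defines "A \<equiv> (\<Sum>i = 1..n + m. a i)"
  shows "S_eigenvalue n m a l \<longleftrightarrow>
    (real n + real m) * l \<le> A \<and> 4 * l \<le> 1 \<and> (real n - real m + 2) * l \<le> real n - A \<and>
    ((real n + real m) * l = A \<or> 4 * l = 1 \<or> (real n - real m + 2) * l = real n - A)"
proof -
  have "{1..n + m} = insert n (insert (n + m) ({1..<n} \<union> {n + 1..<n + m}))"
    using assms by auto
  moreover have "{1..<n} \<inter> {n + 1..<n + m} = {}" by auto
  ultimately have A: "A = sum a {1..<n} + sum a {n + 1..<n + m} + a n + a (n + m)"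
    using assms by (simp add: A_def sum.union_disjoint)
  have nm: "1 < real n" "1 < real m" using assms by simp_all
  show ?thesis
    unfolding S_eigenvalue_def S_system_iff_junction_system[OF assms(1,2)] A
    using junction_system_necessary[OF _ \<open>l > 0\<close> nm]
      junction_system_sufficient[OF \<open>l > 0\<close> less_imp_le[OF nm(1)] less_imp_le[OF nm(2)]]
    by blast
qed

theorem theorem3:
  fixes n m :: nat and a :: "nat \<Rightarrow> real"
  assumes "n \<ge> 2" and "m \<ge> 2"
    and "admissible n m a"
    and "ratio n m > 1 / 2"
    and "0 < density n m a" and "density n m a < ratio n m"
  shows "let d = density n m a; r = ratio n m; \<rho> = rho n m;
             lam = Min {d / (1 + \<rho>), 1 / 4, (r - d) / (2 * r - 1 + \<rho>)}
         in 0 < lam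
            \<and> {l. 0 < l \<and> S_eigenvalue n m a l} = {lam}
            \<and> {l. 0 < l \<and> EV_eigenvalue n m a l} = {lam}"
proof -
  define A where "A = (\<Sum>i = 1..n + m. a i)"
  define K where "K = real n + real m - 1"
  have K: "K > 0" using assms by (simp add: K_def)
  have d: "density n m a = A / K" and r: "ratio n m = n / K" and rho: "rho n m = 1 / K"
    by (simp_all add: density_def ratio_def rho_def A_def K_def)
  \<comment> \<open>\<open>ratio n m > 1 / 2\<close> says \<open>2 * n > K\<close>, that is,
    \<open>n - m + 1 > 0\<close> over the reals.\<close>
  have Q: "real n - real m + 2 > 0" using assms(4) K unfolding r by (simp add: field_simps K_def)
  have A: "0 < A" "A < real n" using assms(5,6) K by (simp_all add: d r field_simps)
  \<comment> \<open>Both quotients are expanded by \<open>K\<close>; here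
    \<open>K + 1 = n + m\<close>.\<close>
  have q1: "A / K / (1 + 1 / K) = A / (real n + real m)"
    using K by (simp add: field_simps) (simp add: K_def algebra_simps)
  have "2 * (n / K) - 1 + 1 / K = (real n - real m + 2) / K" "n / K - A / K = (n - A) / K"
    using K by (simp_all add: field_simps) (simp add: K_def)
  then have q2: "(n / K - A / K) / (2 * (n / K) - 1 + 1 / K) = (n - A) / (real n - real m + 2)"
    using K by simp
  define lam where "lam = Min {A / (real n + real m), 1 / 4, (n - A) / (real n - real m + 2)}"
  have pos: "0 < lam" using A Q assms(1) by (simp add: lam_def)
  have P: "real n + real m > 0" using assms(1) by simp
  have "S_eigenvalue n m a l \<longleftrightarrow> l = lam" if "l > 0" for l
    unfolding S_eigenvalue_iff[OF assms(1,2) that] lam_def eq_Min3_quotients_iff[OF P Q] A_def ..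
  then have "{l. 0 < l \<and> S_eigenvalue n m a l} = {lam}" using pos by auto
  then show ?thesis
    using pos
    by (simp only: Let_def d r rho q1 q2 lam_def[symmetric]
        EV_eigenvalue_iff_S_eigenvalue[OF assms(1,2)] simp_thms)
qed

end
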